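(* Let $G$ be a finite group acting on a finite nonempty set $X$, let $K$ be the classical Burnside kernel on $X$ and $Q$ the dual Burnside kernel on $G^*$, and let $M:=\max_{x\in X}|G_x|$. For all integers $t\ge1$, $$d_Q(t)\le(1-M^{-1})^t,\qquad d_K(t)\le(1-M^{-1})^t.$$ Thus, for every $\varepsilon\in(0,1)$, $$t_{\mathrm{mix}}(Q;\varepsilon)\le\left\lceil M\log\frac1\varepsilon\right\rceil\quad\text{and}\quad t_{\mathrm{mix}}(K;\varepsilon)\le\left\lceil M\log\frac1\varepsilon\right\rceil.$$
   Context: For $g\in G$ and $x\in X$ write $X_g:=\{x\in X: g\cdot x=x\}$, $G_x:=\{g\in G: g\cdot x=x\}$, and $G^*:=\{g\in G: X_g\neq\varnothing\}$. The classical Burnside kernel on $X$ is $$K(x,y)=\frac1{|G_x|}\sum_{g\in G_x\cap G_y}\frac1{|X_g|},$$ with stationary law $\pi_K(x)=|G_x|/(|G|\,|X/G|)$; the dual Burnside kernel on $G^*$ is $$Q(g,h)=\frac1{|X_g|}\sum_{x\in X_g\cap X_h}\frac1{|G_x|},$$ with stationary law $\pi_Q(g)=|X_g|/(|G|\,|X/G|)$. For a kernel $P$ on a finite set $S$ with stationary law $\pi$, $d_P(t):=\max_{s\in S}\|P^t(s,\cdot)-\pi\|_{\mathrm{TV}}$ with $\|\mu-\nu\|_{\mathrm{TV}}=\frac12\sum_{s}|\mu(s)-\nu(s)|$, and $t_{\mathrm{mix}}(P;\varepsilon):=\min\{t\ge0:d_P(t)\le\varepsilon\}$ ($t$ an integer).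 $\log$ is the natural logarithm. *)

theory Defs
  imports Complex_Main "HOL-Algebra.Group_Action"
begin

section \<open>Finite Markov kernels, total variation and mixing times\<close>

text \<open>A kernel on a finite state space \<open>S\<close> is a function \<open>P\<close> whose values \<open>P x y\<close> matter only
  for \<open>x\<close> and \<open>y\<close> in \<open>S\<close>.\<close>

primrec kernel_pow :: "'s set \<Rightarrow> ('s \<Rightarrow> 's \<Rightarrow> real) \<Rightarrow> nat \<Rightarrow> 's \<Rightarrow> 's \<Rightarrow> real" where
  "kernel_pow S P 0 x y = (if x = y then 1 else 0)"
| "kernel_pow S P (Suc t) x y = (\<Sum>z\<in>S. P x z * kernel_pow S P t z y)"

definition tv_dist :: "'s set \<Rightarrow> ('s \<Rightarrow> real) \<Rightarrow> ('s \<Rightarrow> real) \<Rightarrow> real" where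
  "tv_dist S \<mu> \<nu> = 1 / 2 * (\<Sum>s\<in>S. \<bar>\<mu> s - \<nu> s\<bar>)"

definition mix_dist :: "'s set \<Rightarrow> ('s \<Rightarrow> 's \<Rightarrow> real) \<Rightarrow> ('s \<Rightarrow> real) \<Rightarrow> nat \<Rightarrow> real" where
  "mix_dist S P \<pi> t = Max ((\<lambda>s. tv_dist S (kernel_pow S P t s) \<pi>) ` S)"

text \<open>As with any \<open>LEAST\<close> on \<^typ>\<open>nat\<close>, the value is meaningful only if some \<open>t\<close> satisfies the
  inequality.\<close>

definition mixing_time :: "'s set \<Rightarrow> ('s \<Rightarrow> 's \<Rightarrow> real) \<Rightarrow> ('s \<Rightarrow> real) \<Rightarrow> real \<Rightarrow> nat" where
  "mixing_time S P \<pi> \<epsilon> = (LEAST t. mix_dist S P \<pi> t \<le> \<epsilon>)"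

section \<open>Burnside kernels\<close>

text \<open>For an action \<open>\<phi>\<close> of \<open>G\<close> on \<open>X\<close>, the stabilizer $G_x$ is \<open>stabilizer G \<phi> x\<close>, the fixed-point
  set $X_g$ is \<open>invariants X \<phi> g\<close>, and $X/G$ is \<open>orbits G X \<phi>\<close>.\<close>

definition burnside_kernel ::
  "('g, 'm) monoid_scheme \<Rightarrow> 'x set \<Rightarrow> ('g \<Rightarrow> 'x \<Rightarrow> 'x) \<Rightarrow> 'x \<Rightarrow> 'x \<Rightarrow> real" where
  "burnside_kernel G X \<phi> x y =
     1 / real (card (stabilizer G \<phi> x)) *
     (\<Sum>g \<in> stabilizer G \<phi> x \<inter> stabilizer G \<phi> y. 1 / real (card (invariants X \<phi> g)))"

definition burnside_stationary ::
  "('g, 'm) monoid_scheme \<Rightarrow> 'x set \<Rightarrow> ('g \<Rightarrow> 'x \<Rightarrow> 'x) \<Rightarrow> 'x \<Rightarrow> real" where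
  "burnside_stationary G X \<phi> x =
     real (card (stabilizer G \<phi> x)) / (real (card (carrier G)) * real (card (orbits G X \<phi>)))"

definition fixing_elements ::
  "('g, 'm) monoid_scheme \<Rightarrow> 'x set \<Rightarrow> ('g \<Rightarrow> 'x \<Rightarrow> 'x) \<Rightarrow> 'g set" where
  "fixing_elements G X \<phi> = {g \<in> carrier G. invariants X \<phi> g \<noteq> {}}"

definition dual_burnside_kernel ::
  "('g, 'm) monoid_scheme \<Rightarrow> 'x set \<Rightarrow> ('g \<Rightarrow> 'x \<Rightarrow> 'x) \<Rightarrow> 'g \<Rightarrow> 'g \<Rightarrow> real" where
  "dual_burnside_kernel G X \<phi> g h =
     1 / real (card (invariants X \<phi> g)) *
     (\<Sum>x \<in> invariants X \<phi> g \<inter> invariants X \<phi> h. 1 / real (card (stabilizer G \<phi> x)))"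

definition dual_burnside_stationary ::
  "('g, 'm) monoid_scheme \<Rightarrow> 'x set \<Rightarrow> ('g \<Rightarrow> 'x \<Rightarrow> 'x) \<Rightarrow> 'g \<Rightarrow> real" where
  "dual_burnside_stationary G X \<phi> g =
     real (card (invariants X \<phi> g)) / (real (card (carrier G)) * real (card (orbits G X \<phi>)))"

abbreviation d_K where
  "d_K G X \<phi> \<equiv> mix_dist X (burnside_kernel G X \<phi>) (burnside_stationary G X \<phi>)"

abbreviation d_Q where
  "d_Q G X \<phi> \<equiv>
     mix_dist (fixing_elements G X \<phi>) (dual_burnside_kernel G X \<phi>) (dual_burnside_stationary G X \<phi>)"

abbreviation t_mix_K where
  "t_mix_K G X \<phi> \<equiv> mixing_time X (burnside_kernel G X \<phi>) (burnside_stationary G X \<phi>)"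

abbreviation t_mix_Q where
  "t_mix_Q G X \<phi> \<equiv>
     mixing_time (fixing_elements G X \<phi>) (dual_burnside_kernel G X \<phi>)
       (dual_burnside_stationary G X \<phi>)"

end

theory Submission
  imports Defs
begin

text \<open>Both kernels are halves of one two-step walk on the incidence graph \<open>{(x, g). g x = x}\<close>, and
  both satisfy a one-step Doeblin minorization with constant \<open>1 / M\<close> because the identity fixes
  every point: from \<open>x\<close> the walk picks the identity with probability \<open>1 / card G\<^sub>x\<close> and then moves to
  a uniform point of \<open>X\<close>, so \<open>K x y \<ge> 1 / M * (1 / card X)\<close>; likewise \<open>Q g \<one> \<ge> 1 / M\<close>.
  Minorization makes \<open>\<mu> \<mapsto> \<mu> P\<close> contract signed measures of total mass 0 by the factor
  \<open>1 - 1 / M\<close> in total variation.\<close>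

section \<open>Doeblin minorization\<close>

text \<open>\<open>kernel_pow\<close> splits off the first step. The contraction acts on the law
  after \<open>t\<close> steps, so the last step has to be split off instead.\<close>

lemma kernel_pow_Suc_right:
  assumes "finite S" "x \<in> S" "y \<in> S"
  shows "kernel_pow S P (Suc t) x y = (\<Sum>z\<in>S. kernel_pow S P t x z * P z y)"
  using assms(2)
proof (induction t arbitrary: x)
  case 0
  have "(\<Sum>z\<in>S. P x z * (if z = y then 1 else 0)) = P x y"
    using assms(1,3) by (simp add: if_distrib cong: if_cong)
  moreover have "(\<Sum>z\<in>S. (if x = z then 1 else 0) * P z y) = P x y"
    using assms(1) 0 by (simp add: if_distrib[of "\<lambda>u. u * _"] cong: if_cong)
  ultimately show ?case by simp
next
  case (Suc t)
  have "kernel_pow S P (Suc (Suc t)) x y = (\<Sum>z\<in>S. P x z * kernel_pow S P (Suc t) z y)"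
    by simp
  also have "\<dots> = (\<Sum>z\<in>S. P x z * (\<Sum>w\<in>S. kernel_pow S P t z w * P w y))"
    using Suc.IH by (intro sum.cong) auto
  also have "\<dots> = (\<Sum>z\<in>S. \<Sum>w\<in>S. P x z * kernel_pow S P t z w * P w y)"
    by (simp add: sum_distrib_left mult.assoc)
  also have "\<dots> = (\<Sum>w\<in>S. \<Sum>z\<in>S. P x z * kernel_pow S P t z w * P w y)"
    by (rule sum.swap)
  also have "\<dots> = (\<Sum>w\<in>S. kernel_pow S P (Suc t) x w * P w y)"
    by (simp add: sum_distrib_right)
  finally show ?case .
qed

locale minorized_kernel =
  fixes S :: "'s set" and P :: "'s \<Rightarrow> 's \<Rightarrow> real" and \<pi> \<nu> :: "'s \<Rightarrow> real" and \<delta> :: real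
  assumes fin: "finite S" and nonempty: "S \<noteq> {}"
    and row_sum: "x \<in> S \<Longrightarrow> (\<Sum>y\<in>S. P x y) = 1"
    and stat_nonneg: "x \<in> S \<Longrightarrow> 0 \<le> \<pi> x"
    and stat_sum: "(\<Sum>x\<in>S. \<pi> x) = 1"
    and stationary: "y \<in> S \<Longrightarrow> (\<Sum>x\<in>S. \<pi> x * P x y) = \<pi> y"
    and minor_sum: "(\<Sum>y\<in>S. \<nu> y) = 1"
    and minorization: "x \<in> S \<Longrightarrow> y \<in> S \<Longrightarrow> \<delta> * \<nu> y \<le> P x y"
begin

lemma kernel_pow_sum: "x \<in> S \<Longrightarrow> (\<Sum>y\<in>S. kernel_pow S P t x y) = 1"
proof (induction t arbitrary: x)
  case 0
  then show ?case using fin by simp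
next
  case (Suc t)
  have "(\<Sum>y\<in>S. kernel_pow S P (Suc t) x y) = (\<Sum>z\<in>S. P x z * (\<Sum>y\<in>S. kernel_pow S P t z y))"
    by (simp add: sum_distrib_left) (rule sum.swap)
  also have "\<dots> = 1"
    using Suc by (simp add: row_sum)
  finally show ?case .
qed

text \<open>As \<open>\<mu>\<close> has total mass 0, removing the common part
  \<open>\<delta> * \<nu> y\<close> from every row leaves the image of \<open>\<mu>\<close>
  unchanged. The reduced rows are nonnegative and sum to \<open>1 - \<delta>\<close>, so the
  triangle inequality suffices.\<close>

lemma l1_contraction:
  assumes "(\<Sum>x\<in>S. \<mu> x) = 0"
  shows "(\<Sum>y\<in>S. \<bar>\<Sum>x\<in>S. \<mu> x * P x y\<bar>) \<le> (1 - \<delta>) * (\<Sum>x\<in>S. \<bar>\<mu> x\<bar>)"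
proof -
  have "(\<Sum>x\<in>S. \<mu> x * P x y) = (\<Sum>x\<in>S. \<mu> x * (P x y - \<delta> * \<nu> y))" for y
    using assms by (simp add: right_diff_distrib sum_subtractf flip: sum_distrib_right)
  then have "(\<Sum>y\<in>S. \<bar>\<Sum>x\<in>S. \<mu> x * P x y\<bar>) \<le> (\<Sum>y\<in>S. \<Sum>x\<in>S. \<bar>\<mu> x\<bar> * (P x y - \<delta> * \<nu> y))"
    using minorization by (auto intro!: sum_mono order.trans[OF sum_abs] simp: abs_mult)
  also have "\<dots> = (\<Sum>x\<in>S. \<bar>\<mu> x\<bar> * (\<Sum>y\<in>S. P x y - \<delta> * \<nu> y))"
    by (subst sum.swap) (simp add: sum_distrib_left)
  also have "\<dots> = (\<Sum>x\<in>S. \<bar>\<mu> x\<bar> * (1 - \<delta>))"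
    by (intro sum.cong) (simp_all add: sum_subtractf row_sum minor_sum flip: sum_distrib_left)
  finally show ?thesis
    by (simp add: sum_distrib_left mult.commute)
qed

lemma le_one: "\<delta> \<le> 1"
proof -
  obtain x where "x \<in> S" using nonempty by blast
  then have "(\<Sum>y\<in>S. \<delta> * \<nu> y) \<le> (\<Sum>y\<in>S. P x y)"
    by (intro sum_mono minorization)
  then show ?thesis
    using \<open>x \<in> S\<close> by (simp add: row_sum minor_sum flip: sum_distrib_left)
qed

lemma l1_dist_kernel_pow_le:
  assumes "x \<in> S"
  shows "(\<Sum>y\<in>S. \<bar>kernel_pow S P t x y - \<pi> y\<bar>) \<le> 2 * (1 - \<delta>) ^ t"
proof (induction t)
  case 0
  \<comment> \<open>Two probability vectors are at L1 distance at most 2; this constant later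
    cancels the 1/2 in \<open>tv_dist\<close>.\<close>
  have "(\<Sum>y\<in>S. \<bar>kernel_pow S P 0 x y - \<pi> y\<bar>) \<le> (\<Sum>y\<in>S. (if x = y then 1 else 0) + \<pi> y)"
    using stat_nonneg by (intro sum_mono) force
  also have "\<dots> = 2"
    using assms fin by (simp add: sum.distrib stat_sum)
  finally show ?case by simp
next
  case (Suc t)
  define \<mu> where "\<mu> y = kernel_pow S P t x y - \<pi> y" for y
  \<comment> \<open>Stationarity rewrites \<open>\<pi>\<close> as its own image under
    \<open>P\<close>, so one more step maps the difference \<open>\<mu>\<close> to its
    image.\<close>
  have "kernel_pow S P (Suc t) x y - \<pi> y = (\<Sum>z\<in>S. \<mu> z * P z y)" if "y \<in> S" for y
    unfolding kernel_pow_Suc_right[OF fin assms that]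
    by (subst stationary[OF that, symmetric]) (simp add: \<mu>_def left_diff_distrib sum_subtractf)
  then have "(\<Sum>y\<in>S. \<bar>kernel_pow S P (Suc t) x y - \<pi> y\<bar>) = (\<Sum>y\<in>S. \<bar>\<Sum>z\<in>S. \<mu> z * P z y\<bar>)"
    by (intro sum.cong) (simp_all del: kernel_pow.simps)
  also have "\<dots> \<le> (1 - \<delta>) * (\<Sum>y\<in>S. \<bar>\<mu> y\<bar>)"
    using assms by (intro l1_contraction) (simp add: \<mu>_def sum_subtractf kernel_pow_sum stat_sum)
  also have "\<dots> \<le> (1 - \<delta>) * (2 * (1 - \<delta>) ^ t)"
    using Suc le_one unfolding \<mu>_def by (intro mult_left_mono) auto
  finally show ?case by (simp add: mult_ac del: kernel_pow.simps)
qed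

theorem mix_dist_le: "mix_dist S P \<pi> t \<le> (1 - \<delta>) ^ t"
  unfolding mix_dist_def tv_dist_def
  using fin nonempty l1_dist_kernel_pow_le by (auto simp: mult.commute)

theorem mixing_time_le:
  assumes "0 < \<delta>" "0 < \<epsilon>" "\<epsilon> < 1"
  shows "int (mixing_time S P \<pi> \<epsilon>) \<le> \<lceil>ln (1 / \<epsilon>) / \<delta>\<rceil>"
proof -
  define n where "n = nat \<lceil>ln (1 / \<epsilon>) / \<delta>\<rceil>"
  have pos: "0 \<le> ln (1 / \<epsilon>) / \<delta>"
    using assms by simp
  then have "ln (1 / \<epsilon>) / \<delta> \<le> real n"
    unfolding n_def by linarith
  then have "ln (1 / \<epsilon>) \<le> real n * \<delta>"
    using assms(1) by (simp add: field_simps)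
  have "mix_dist S P \<pi> n \<le> (1 - \<delta>) ^ n"
    by (rule mix_dist_le)
  \<comment> \<open>Uses \<open>1 - \<delta> \<le> exp (- \<delta>)\<close>; \<open>le_one\<close>
    keeps the base nonnegative, as monotonicity of powers requires.\<close>
  also have "\<dots> \<le> exp (- \<delta>) ^ n"
    using le_one exp_ge_add_one_self[of "- \<delta>"] by (intro power_mono) auto
  also have "\<dots> = exp (- (real n * \<delta>))"
    by (simp flip: exp_of_nat_mult)
  also have "\<dots> \<le> exp (- ln (1 / \<epsilon>))"
    using \<open>ln (1 / \<epsilon>) \<le> real n * \<delta>\<close> by simp
  also have "\<dots> = \<epsilon>"
    using assms by (simp add: ln_div)
  finally have "mixing_time S P \<pi> \<epsilon> \<le> n"
    unfolding mixing_time_def by (rule Least_le)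
  then show ?thesis
    using pos unfolding n_def by linarith
qed

end

section \<open>Two-step walks on a bipartite incidence relation\<close>

text \<open>The relation is recorded by both neighbourhood maps, so that exchanging the sides is
  again an instance: the two Burnside kernels are the same walk seen from either side.\<close>

locale incidence =
  fixes A :: "'a set" and B :: "'b set" and F :: "'a \<Rightarrow> 'b set" and F' :: "'b \<Rightarrow> 'a set"
  assumes finite_left: "finite A" and finite_right: "finite B"
    and sub: "a \<in> A \<Longrightarrow> F a \<subseteq> B" and sub': "b \<in> B \<Longrightarrow> F' b \<subseteq> A"
    and nonempty: "a \<in> A \<Longrightarrow> F a \<noteq> {}" and nonempty': "b \<in> B \<Longrightarrow> F' b \<noteq> {}"
    and mem_iff: "a \<in> A \<Longrightarrow> b \<in> B \<Longrightarrow> b \<in> F a \<longleftrightarrow> a \<in> F' b"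
begin

lemma flip: "incidence B A F' F"
  using finite_left finite_right sub sub' nonempty nonempty' mem_iff by unfold_locales auto

text \<open>Draw a uniform neighbour \<open>b\<close> of \<open>a\<close>, then a uniform neighbour
  of \<open>b\<close>; the sum runs over the midpoints leading to \<open>c\<close>.\<close>

definition walk :: "'a \<Rightarrow> 'a \<Rightarrow> real" where
  "walk a c = 1 / real (card (F a)) * (\<Sum>b \<in> F a \<inter> F c. 1 / real (card (F' b)))"

lemma finite_F: "a \<in> A \<Longrightarrow> finite (F a)"
  using sub finite_right finite_subset by blast

lemma card_F_pos: "a \<in> A \<Longrightarrow> 0 < card (F a)"
  using finite_F nonempty by (simp add: card_gt_0_iff)

lemma card_F'_pos: "b \<in> B \<Longrightarrow> 0 < card (F' b)"
  using incidence.card_F_pos[OF flip] .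

lemma sum_swap:
  fixes f :: "'a \<Rightarrow> 'b \<Rightarrow> real"
  shows "(\<Sum>a\<in>A. \<Sum>b\<in>F a. f a b) = (\<Sum>b\<in>B. \<Sum>a\<in>F' b. f a b)"
proof -
  have "(\<Sum>a\<in>A. \<Sum>b\<in>F a. f a b) = (\<Sum>a\<in>A. \<Sum>b | b \<in> B \<and> b \<in> F a. f a b)"
    using sub by (intro sum.cong) auto
  also have "\<dots> = (\<Sum>b\<in>B. \<Sum>a | a \<in> A \<and> b \<in> F a. f a b)"
    by (rule sum.swap_restrict[OF finite_left finite_right])
  also have "\<dots> = (\<Sum>b\<in>B. \<Sum>a\<in>F' b. f a b)"
    using sub' mem_iff by (intro sum.cong) auto
  finally show ?thesis .
qed

text \<open>Both sides count incident pairs. Hence the two stationary laws share one normalizing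
  constant.\<close>

lemma card_sum_eq: "(\<Sum>a\<in>A. card (F a)) = (\<Sum>b\<in>B. card (F' b))"
proof -
  have "real (\<Sum>a\<in>A. card (F a)) = real (\<Sum>b\<in>B. card (F' b))"
    using sum_swap[of "\<lambda>_ _. 1"] by simp
  then show ?thesis by linarith
qed

text \<open>After the sums are exchanged, each \<open>b\<close> in \<open>F c\<close> contributes
  \<open>card (F' b)\<close> terms \<open>1 / card (F' b)\<close>, hence 1. The inner sum is
  symmetric in \<open>a\<close> and \<open>c\<close>, so this one identity yields both the row sums
  and stationarity.\<close>

lemma walk_mass:
  assumes "c \<in> A"
  shows "(\<Sum>a\<in>A. \<Sum>b\<in>F a \<inter> F c. 1 / real (card (F' b))) = card (F c)"
proof -
  have "(\<Sum>a\<in>A. \<Sum>b\<in>F a \<inter> F c. 1 / real (card (F' b)))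
      = (\<Sum>a\<in>A. \<Sum>b\<in>F a. if b \<in> F c then 1 / real (card (F' b)) else 0)"
    by (rule sum.cong) (simp_all add: sum.inter_restrict finite_F)
  also have "\<dots> = (\<Sum>b\<in>B. \<Sum>a\<in>F' b. if b \<in> F c then 1 / real (card (F' b)) else 0)"
    by (rule sum_swap)
  also have "\<dots> = (\<Sum>b\<in>B. if b \<in> F c then 1 else 0)"
    by (intro sum.cong) (auto dest: card_F'_pos)
  also have "\<dots> = card (B \<inter> F c)"
    using finite_right by (simp flip: sum.inter_restrict)
  finally show ?thesis
    using sub[OF assms] by (simp add: Int_absorb1)
qed

lemma walk_row_sum: "a \<in> A \<Longrightarrow> (\<Sum>c\<in>A. walk a c) = 1"
  using walk_mass[of a] card_F_pos[of a]
  by (simp add: walk_def Int_commute[of "F a"] flip: sum_divide_distrib)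

lemma walk_stationary:
  assumes "c \<in> A"
  shows "(\<Sum>a\<in>A. real (card (F a)) / Z * walk a c) = real (card (F c)) / Z"
proof -
  have "(\<Sum>a\<in>A. real (card (F a)) / Z * walk a c)
      = (\<Sum>a\<in>A. (\<Sum>b\<in>F a \<inter> F c. 1 / real (card (F' b))) / Z)"
    using nonempty finite_F by (intro sum.cong) (auto simp: walk_def)
  then show ?thesis
    using walk_mass[OF assms] by (simp flip: sum_divide_distrib)
qed

lemma minorized_kernel_walk:
  assumes "A \<noteq> {}" and Z: "Z = (\<Sum>a\<in>A. real (card (F a)))"
    and "(\<Sum>c\<in>A. \<nu> c) = 1" and "\<And>a c. a \<in> A \<Longrightarrow> c \<in> A \<Longrightarrow> \<delta> * \<nu> c \<le> walk a c"
  shows "minorized_kernel A walk (\<lambda>a. real (card (F a)) / Z) \<nu> \<delta>"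
proof
  have "0 < Z"
    unfolding Z using assms(1) finite_left card_F_pos by (intro sum_pos) auto
  then show "(\<Sum>a\<in>A. real (card (F a)) / Z) = 1"
    by (simp add: Z flip: sum_divide_distrib)
  show "0 \<le> real (card (F a)) / Z" for a
    using \<open>0 < Z\<close> by simp
qed (use assms finite_left walk_row_sum walk_stationary in auto)

text \<open>Keep only the midpoint \<open>b\<^sub>0\<close>, which is adjacent to all of
  \<open>A\<close>: it is drawn with probability at least \<open>1 / M\<close>, and the next point
  is then uniform on \<open>A\<close>.\<close>

lemma walk_ge_uniform:
  assumes "a \<in> A" "c \<in> A" "b\<^sub>0 \<in> B" "F' b\<^sub>0 = A" "card (F a) \<le> M"
  shows "1 / real M * (1 / real (card A)) \<le> walk a c"
proof -
  have b0: "b\<^sub>0 \<in> F a \<inter> F c"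
    using assms by (simp add: mem_iff)
  have "1 / real (card A) \<le> (\<Sum>b \<in> F a \<inter> F c. 1 / real (card (F' b)))"
    using member_le_sum[OF b0, of "\<lambda>b. 1 / real (card (F' b))"] finite_F assms by simp
  moreover have "1 / real M \<le> 1 / real (card (F a))"
    using card_F_pos[OF assms(1)] assms(5) by (simp add: frac_le)
  ultimately show ?thesis
    unfolding walk_def by (intro mult_mono) auto
qed

text \<open>Every midpoint \<open>b\<close> is adjacent to \<open>a\<^sub>0\<close>, so the second
  step hits \<open>a\<^sub>0\<close> with probability \<open>1 / card (F' b)\<close>, whichever
  \<open>b\<close> was drawn.\<close>

lemma walk_ge_point_mass:
  assumes "a \<in> A" "c \<in> A" "a\<^sub>0 \<in> A" "F a\<^sub>0 = B" "\<And>b. b \<in> B \<Longrightarrow> card (F' b) \<le> M"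
  shows "1 / real M * (if c = a\<^sub>0 then 1 else 0) \<le> walk a c"
proof (cases "c = a\<^sub>0")
  case True
  then have int: "F a \<inter> F c = F a"
    using assms sub by auto
  have "(\<Sum>b \<in> F a. 1 / real M) \<le> (\<Sum>b \<in> F a. 1 / real (card (F' b)))"
    using assms sub card_F'_pos by (intro sum_mono frac_le) auto
  then show ?thesis
    using True card_F_pos[OF assms(1)] int by (simp add: walk_def field_simps)
next
  case False
  then show ?thesis
    by (simp add: walk_def sum_nonneg)
qed

end

section \<open>The fixed-point incidence of a group action\<close>

lemma (in group_action) incidence_stabilizer_invariants:
  assumes "finite (carrier G)" "finite E"
  shows "incidence E (fixing_elements G E \<phi>) (stabilizer G \<phi>) (invariants E \<phi>)"
proof
  show "stabilizer G \<phi> x \<noteq> {}" if "x \<in> E" for x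
    using stabilizer_one_closed[OF that] by blast
qed (use assms in \<open>auto simp: fixing_elements_def stabilizer_def invariants_def\<close>)

theorem theorem3p23:
  fixes G :: "('g, 'm) monoid_scheme"
    and X :: "'x set"
    and \<phi> :: "'g \<Rightarrow> 'x \<Rightarrow> 'x"
    and M :: nat
  assumes "group_action G X \<phi>"
    and "finite (carrier G)"
    and "finite X"
    and "X \<noteq> {}"
    and "M = Max ((\<lambda>x. card (stabilizer G \<phi> x)) ` X)"
  shows "(\<forall>t\<ge>1. d_Q G X \<phi> t \<le> (1 - 1 / real M) ^ t \<and> d_K G X \<phi> t \<le> (1 - 1 / real M) ^ t) \<and>
    (\<forall>\<epsilon>::real. 0 < \<epsilon> \<and> \<epsilon> < 1 \<longrightarrow>
      int (t_mix_Q G X \<phi> \<epsilon>) \<le> \<lceil>real M * ln (1 / \<epsilon>)\<rceil> \<and>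
      int (t_mix_K G X \<phi> \<epsilon>) \<le> \<lceil>real M * ln (1 / \<epsilon>)\<rceil>)"
proof -
  interpret group_action G X \<phi> by fact
  let ?S = "stabilizer G \<phi>" and ?I = "invariants X \<phi>" and ?H = "fixing_elements G X \<phi>"
  define Z where "Z = real (card (carrier G)) * real (card (orbits G X \<phi>))"
  interpret K: incidence X ?H ?S ?I
    by (rule incidence_stabilizer_invariants) fact+
  interpret Q: incidence ?H X ?I ?S
    by (rule K.flip)
  have M: "card (?S x) \<le> M" if "x \<in> X" for x
    using assms that by simp
  obtain x where "x \<in> X" using assms by blast
  then have "0 < M"
    using M K.card_F_pos[of x] by fastforce
  have inv_one: "?I \<one>\<^bsub>G\<^esub> = X"
    by (auto simp: invariants_def simp flip: id_eq_one)
  then have one: "\<one>\<^bsub>G\<^esub> \<in> ?H"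
    using assms group_hom by (auto simp: fixing_elements_def group_hom_def group_def)
  \<comment> \<open>Elements outside \<open>?H\<close> fix no point and contribute 0; the sum over
    the whole group is the one in Burnside's lemma, which identifies \<open>Z\<close> as the number
    of incident pairs.\<close>
  have "(\<Sum>g\<in>?H. card (?I g)) = (\<Sum>g\<in>carrier G. card (?I g))"
    using assms(2) by (intro sum.mono_neutral_left) (auto simp: fixing_elements_def)
  then have "(\<Sum>g\<in>?H. card (?I g)) = card (carrier G) * card (orbits G X \<phi>)"
    using burnside[OF assms(2,3)] by (simp add: order_def mult.commute)
  then have Z_Q: "Z = (\<Sum>g\<in>?H. real (card (?I g)))"
    by (simp add: Z_def flip: of_nat_sum of_nat_mult)
  then have Z_K: "Z = (\<Sum>x\<in>X. real (card (?S x)))"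
    using K.card_sum_eq by (simp flip: of_nat_sum)
  have "minorized_kernel X K.walk (\<lambda>x. real (card (?S x)) / Z) (\<lambda>_. 1 / real (card X)) (1 / real M)"
    using assms(3,4) Z_K K.walk_ge_uniform[OF _ _ one inv_one M]
    by (intro K.minorized_kernel_walk) auto
  moreover have "K.walk = burnside_kernel G X \<phi>"
    by (intro ext) (simp add: K.walk_def burnside_kernel_def)
  moreover have "(\<lambda>x. real (card (?S x)) / Z) = burnside_stationary G X \<phi>"
    by (intro ext) (simp add: Z_def burnside_stationary_def)
  ultimately interpret DK: minorized_kernel X "burnside_kernel G X \<phi>" "burnside_stationary G X \<phi>"
    "\<lambda>_. 1 / real (card X)" "1 / real M" by simp
  \<comment> \<open>On the dual side the minorizing law is the point mass at the identity, where
    \<open>K\<close> used the uniform law on \<open>X\<close>; \<open>M\<close> bounds stabilizers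
    in both cases.\<close>
  have "minorized_kernel ?H Q.walk (\<lambda>g. real (card (?I g)) / Z)
      (\<lambda>g. if g = \<one>\<^bsub>G\<^esub> then 1 else 0) (1 / real M)"
    using one Z_Q Q.finite_left Q.walk_ge_point_mass[OF _ _ one inv_one M]
    by (intro Q.minorized_kernel_walk) auto
  moreover have "Q.walk = dual_burnside_kernel G X \<phi>"
    by (intro ext) (simp add: Q.walk_def dual_burnside_kernel_def)
  moreover have "(\<lambda>g. real (card (?I g)) / Z) = dual_burnside_stationary G X \<phi>"
    by (intro ext) (simp add: Z_def dual_burnside_stationary_def)
  ultimately interpret DQ: minorized_kernel ?H "dual_burnside_kernel G X \<phi>"
    "dual_burnside_stationary G X \<phi>" "\<lambda>g. if g = \<one>\<^bsub>G\<^esub> then 1 else 0" "1 / real M" by simp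
  \<comment> \<open>For \<open>\<delta> = 1 / M\<close> the quotient
    \<open>ln (1 / \<epsilon>) / \<delta>\<close> is \<open>M * ln (1 / \<epsilon>)\<close>, and
    \<open>0 < M\<close> makes \<open>\<delta>\<close> positive.\<close>
  show ?thesis
    using DK.mix_dist_le DQ.mix_dist_le DK.mixing_time_le DQ.mixing_time_le \<open>0 < M\<close>
    by (simp add: mult.commute)
qed

end
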